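(* Let $M_1=(S_1,r_1)$ and $M_2=(S_2,r_2)$ be matroids, let $B_1$ be a basis of $M_1$ and $B_2$ a basis of $M_2$, and let $S=S_1\times S_2$. Let $N_1$ be the matroid on $S_1\times B_2$ with rank function $X\mapsto\sum_{e_2\in B_2} r_1(\{x\in S_1:(x,e_2)\in X\})$ (the direct sum of copies of $M_1$ indexed by $B_2$), and $N_2$ the matroid on $B_1\times S_2$ with rank function $X\mapsto\sum_{e_1\in B_1} r_2(\{y\in S_2:(e_1,y)\in X\})$. If $M=(S,r)$ is a matroid such that every element of $(S_1\setminus B_1)\times(S_2\setminus B_2)$ is a loop of $M$ and the restriction $M|((S_1\times B_2)\cup(B_1\times S_2))$ is an amalgam of $N_1$ and $N_2$, then $M$ is a coupling of $M_1$ and $M_2$.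
   Context: For matroids $N_1$ on $T_1$ and $N_2$ on $T_2$ whose restrictions to $T_1\cap T_2$ coincide, an amalgam of $N_1$ and $N_2$ is a matroid $N$ on $T_1\cup T_2$ with $N|T_1=N_1$ and $N|T_2=N_2$ ($N|T$ denotes restriction). A loop is an element of rank $0$. A matroid $M=(S_1\times S_2,r)$ is a coupling of $M_1=(S_1,r_1)$ and $M_2=(S_2,r_2)$ if $r(X_1\times S_2)=r_1(X_1)r_2(S_2)$ for all $X_1\subseteq S_1$ and $r(S_1\times X_2)=r_1(S_1)r_2(X_2)$ for all $X_2\subseteq S_2$. *)

theory Defs
  imports Main
begin

text \<open>
  A matroid \<open>(S, r)\<close> is a finite ground set \<open>S\<close> with a rank function \<open>r\<close>. The function \<open>r\<close> is total on
  the type, but only its values on subsets of \<open>S\<close> carry meaning. Hence the restriction of \<open>(S, r)\<close>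
  to \<open>T \<subseteq> S\<close> is \<open>(T, r)\<close>, and two matroids \<open>(T, r)\<close> and \<open>(T, r')\<close> are equal iff \<open>r\<close> and \<open>r'\<close> agree on
  all subsets of \<open>T\<close>.
\<close>

locale matroid =
  fixes S :: "'a set" and r :: "'a set \<Rightarrow> nat"
  assumes finite_ground: "finite S"
    and rank_le_card: "X \<subseteq> S \<Longrightarrow> r X \<le> card X"
    and rank_mono: "X \<subseteq> Y \<Longrightarrow> Y \<subseteq> S \<Longrightarrow> r X \<le> r Y"
    and rank_submodular: "X \<subseteq> S \<Longrightarrow> Y \<subseteq> S \<Longrightarrow> r (X \<union> Y) + r (X \<inter> Y) \<le> r X + r Y"

definition matroid_indep :: "'a set \<Rightarrow> ('a set \<Rightarrow> nat) \<Rightarrow> 'a set \<Rightarrow> bool" where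
  "matroid_indep S r I \<longleftrightarrow> I \<subseteq> S \<and> r I = card I"

definition matroid_basis :: "'a set \<Rightarrow> ('a set \<Rightarrow> nat) \<Rightarrow> 'a set \<Rightarrow> bool" where
  "matroid_basis S r B \<longleftrightarrow>
     matroid_indep S r B \<and> (\<forall>I. matroid_indep S r I \<and> B \<subseteq> I \<longrightarrow> I = B)"

definition matroid_loop :: "'a set \<Rightarrow> ('a set \<Rightarrow> nat) \<Rightarrow> 'a \<Rightarrow> bool" where
  "matroid_loop S r e \<longleftrightarrow> e \<in> S \<and> r {e} = 0"

definition matroid_amalgam ::
  "'a set \<Rightarrow> ('a set \<Rightarrow> nat) \<Rightarrow> 'a set \<Rightarrow> ('a set \<Rightarrow> nat) \<Rightarrow> 'a set \<Rightarrow> ('a set \<Rightarrow> nat) \<Rightarrow> bool" where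
  "matroid_amalgam T1 n1 T2 n2 T n \<longleftrightarrow>
     T = T1 \<union> T2 \<and> matroid T n \<and>
     (\<forall>X. X \<subseteq> T1 \<longrightarrow> n X = n1 X) \<and> (\<forall>X. X \<subseteq> T2 \<longrightarrow> n X = n2 X)"

text \<open>
  The standing assumptions on the two matroids to be amalgamated need not be part of the
  definition: they follow from the existence of an amalgam.
\<close>

lemma matroid_restrict:
  assumes "matroid S r" and "T \<subseteq> S" and "\<And>X. X \<subseteq> T \<Longrightarrow> r X = r' X"
  shows "matroid T r'"
proof -
  interpret matroid S r by fact
  show ?thesis
  proof
    show "finite T" using assms(2) finite_ground by (rule finite_subset)
    show "r' X \<le> card X" if "X \<subseteq> T" for X
      using rank_le_card[of X] that assms(2) assms(3)[of X] by auto
    show "r' X \<le> r' Y" if "X \<subseteq> Y" "Y \<subseteq> T" for X Y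
      using rank_mono[of X Y] that assms(2) assms(3)[of X] assms(3)[of Y] by auto
    show "r' (X \<union> Y) + r' (X \<inter> Y) \<le> r' X + r' Y" if "X \<subseteq> T" "Y \<subseteq> T" for X Y
    proof -
      have "X \<union> Y \<subseteq> T" "X \<inter> Y \<subseteq> T" "X \<subseteq> S" "Y \<subseteq> S" using that assms(2) by auto
      then show ?thesis
        using rank_submodular[of X Y] that by (simp add: assms(3)[symmetric])
    qed
  qed
qed

lemma matroid_amalgam_standing:
  assumes "matroid_amalgam T1 n1 T2 n2 T n"
  shows "matroid T1 n1" and "matroid T2 n2" and "X \<subseteq> T1 \<inter> T2 \<Longrightarrow> n1 X = n2 X"
proof -
  have n: "matroid T n" "T1 \<subseteq> T" "T2 \<subseteq> T"
    and eq: "\<And>X. X \<subseteq> T1 \<Longrightarrow> n X = n1 X" "\<And>X. X \<subseteq> T2 \<Longrightarrow> n X = n2 X"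
    using assms by (auto simp: matroid_amalgam_def)
  show "matroid T1 n1" using n(1,2) eq(1) by (rule matroid_restrict)
  show "matroid T2 n2" using n(1,3) eq(2) by (rule matroid_restrict)
  show "n1 X = n2 X" if "X \<subseteq> T1 \<inter> T2"
    using that eq(1)[of X] eq(2)[of X] by simp
qed

text \<open>
  Rank functions of the direct sum of copies of \<open>(S1, r1)\<close> indexed by \<open>B2\<close>, on \<open>S1 \<times> B2\<close>, and of
  copies of \<open>(S2, r2)\<close> indexed by \<open>B1\<close>, on \<open>B1 \<times> S2\<close>.
\<close>

definition row_copies_rank ::
  "'a set \<Rightarrow> ('a set \<Rightarrow> nat) \<Rightarrow> 'b set \<Rightarrow> ('a \<times> 'b) set \<Rightarrow> nat" where
  "row_copies_rank S1 r1 B2 X = (\<Sum>e2\<in>B2. r1 {x \<in> S1. (x, e2) \<in> X})"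

definition column_copies_rank ::
  "'a set \<Rightarrow> 'b set \<Rightarrow> ('b set \<Rightarrow> nat) \<Rightarrow> ('a \<times> 'b) set \<Rightarrow> nat" where
  "column_copies_rank B1 S2 r2 X = (\<Sum>e1\<in>B1. r2 {y \<in> S2. (e1, y) \<in> X})"

definition matroid_coupling ::
  "'a set \<Rightarrow> ('a set \<Rightarrow> nat) \<Rightarrow> 'b set \<Rightarrow> ('b set \<Rightarrow> nat) \<Rightarrow> (('a \<times> 'b) set \<Rightarrow> nat) \<Rightarrow> bool" where
  "matroid_coupling S1 r1 S2 r2 r \<longleftrightarrow>
     matroid (S1 \<times> S2) r \<and>
     (\<forall>X1. X1 \<subseteq> S1 \<longrightarrow> r (X1 \<times> S2) = r1 X1 * r2 S2) \<and>
     (\<forall>X2. X2 \<subseteq> S2 \<longrightarrow> r (S1 \<times> X2) = r1 S1 * r2 X2)"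

end

(* Idea: X1 \<times> S2 has the same rank as X1 \<times> B2, and dually.  An element (x, y) with y outside B2 is a
   loop if x is outside B1; otherwise it is spanned by {x} \<times> B2, which has the full rank of the
   copy {x} \<times> S2 of M2. *)
theory Submission
  imports Defs
begin

context matroid
begin

lemma rank_empty: "r {} = 0"
  using rank_le_card[of "{}"] by simp

text \<open>Being spanned passes from \<open>C\<close> to any larger \<open>A\<close>: for
  \<open>e\<close> outside \<open>A\<close>, the sets \<open>insert e C\<close> and \<open>A\<close>
  have union \<open>insert e A\<close> and intersection \<open>C\<close>, so submodularity bounds
  the gain over \<open>A\<close> by the gain over \<open>C\<close>, which is zero.\<close>

lemma rank_insert_spanned:
  assumes "C \<subseteq> A" "A \<subseteq> S" "e \<in> S" "r (insert e C) \<le> r C"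
  shows "r (insert e A) = r A"
proof (cases "e \<in> A")
  case False
  then have "insert e C \<union> A = insert e A" "insert e C \<inter> A = C"
    using assms(1) by auto
  moreover have "r (insert e C \<union> A) + r (insert e C \<inter> A) \<le> r (insert e C) + r A"
    using assms by (intro rank_submodular) auto
  moreover have "r A \<le> r (insert e A)"
    using assms by (intro rank_mono) auto
  ultimately show ?thesis using assms(4) by simp
qed (simp add: insert_absorb)

text \<open>The elements of \<open>E - A\<close> are added to \<open>A\<close> one at a time. The
  witness \<open>C\<close> may vary with \<open>e\<close>; since it lies inside \<open>A\<close>, it
  still spans \<open>e\<close> after other elements have been added.\<close>

lemma rank_eq_if_spanned:
  assumes "A \<subseteq> E" "E \<subseteq> S"
    and "\<And>e. e \<in> E - A \<Longrightarrow> \<exists>C\<subseteq>A. r (insert e C) \<le> r C"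
  shows "r E = r A"
proof -
  have "finite (E - A)"
    using assms(2) finite_ground by (auto intro: finite_subset)
  then have "r (A \<union> (E - A)) = r A"
    using assms(2,3)
  proof (induction "E - A" arbitrary: E rule: finite_induct)
    case empty
    then show ?case by (metis Un_empty_right)
  next
    case (insert e F)
    \<comment> \<open>The induction hypothesis is used for \<open>E - {e}\<close>, which exceeds
      \<open>A\<close> by exactly \<open>F\<close>.\<close>
    have "r (A \<union> (E - {e} - A)) = r A"
      by (rule insert.hyps(3)) (use insert.hyps insert.prems in auto)
    moreover obtain C where "C \<subseteq> A" "r (insert e C) \<le> r C"
      using insert.prems(2)[of e] insert.hyps(4) by auto
    moreover have "e \<in> S" "A \<subseteq> S"
      using insert.hyps(4) insert.prems assms(1,2) by auto
    ultimately have "r (insert e (A \<union> (E - {e} - A))) = r A"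
      using rank_insert_spanned[of C "A \<union> (E - {e} - A)" e] insert.prems(1) by auto
    moreover have "insert e (A \<union> (E - {e} - A)) = A \<union> (E - A)"
      using insert.hyps(4) by auto
    ultimately show ?case by simp
  qed
  then show ?thesis using assms(1) by (simp add: Un_absorb1)
qed

lemma basis_subset: "matroid_basis S r B \<Longrightarrow> B \<subseteq> S"
  by (simp add: matroid_basis_def matroid_indep_def)

lemma rank_basis: "matroid_basis S r B \<Longrightarrow> r B = card B"
  by (simp add: matroid_basis_def matroid_indep_def)

text \<open>A basis is defined as a maximal independent set; maximality makes it span
  \<open>S\<close>, with \<open>B\<close> itself as the spanning witness for each outside
  element.\<close>

lemma card_basis:
  assumes "matroid_basis S r B"
  shows "card B = r S"
proof -
  have B: "B \<subseteq> S" "r B = card B" and fin: "finite B"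
    using assms basis_subset rank_basis finite_ground by (auto intro: finite_subset)
  have "r S = r B"
  proof (rule rank_eq_if_spanned)
    fix e assume e: "e \<in> S - B"
    then have "\<not> matroid_indep S r (insert e B)"
      using assms unfolding matroid_basis_def by blast
    \<comment> \<open>A dependent set has rank strictly below its size, here
      \<open>card B + 1\<close>, so the rank cannot exceed \<open>card B = r B\<close>.\<close>
    then have "r (insert e B) \<noteq> card (insert e B)"
      using e B(1) by (simp add: matroid_indep_def)
    moreover have "r (insert e B) \<le> card (insert e B)"
      using e B(1) by (intro rank_le_card) auto
    ultimately have "r (insert e B) \<le> r B"
      using e B(2) fin by simp
    then show "\<exists>C\<subseteq>B. r (insert e C) \<le> r C" by blast
  qed (use B in auto)
  then show ?thesis using B by simp
qed

text \<open>On a rectangle each copy indexed by \<open>Y\<close> sees all of \<open>X\<close>, and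
  every other copy sees the empty set, of rank 0.\<close>

lemma row_copies_rank_Times:
  assumes "X \<subseteq> S" "finite B" "Y \<subseteq> B"
  shows "row_copies_rank S r B (X \<times> Y) = r X * card Y"
proof -
  have "row_copies_rank S r B (X \<times> Y) = (\<Sum>e\<in>B. if e \<in> Y then r X else 0)"
    unfolding row_copies_rank_def using assms(1)
    by (intro sum.cong refl) (auto simp: rank_empty intro: arg_cong[where f = r])
  also have "\<dots> = r X * card Y"
    using assms(2,3) by (simp add: sum.If_cases Int_absorb1)
  finally show ?thesis .
qed

lemma column_copies_rank_Times:
  assumes "X \<subseteq> S" "finite B" "Y \<subseteq> B"
  shows "column_copies_rank B S r (Y \<times> X) = card Y * r X"
proof -
  have "column_copies_rank B S r (Y \<times> X) = (\<Sum>e\<in>B. if e \<in> Y then r X else 0)"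
    unfolding column_copies_rank_def using assms(1)
    by (intro sum.cong refl) (auto simp: rank_empty intro: arg_cong[where f = r])
  also have "\<dots> = card Y * r X"
    using assms(2,3) by (simp add: sum.If_cases Int_absorb1)
  finally show ?thesis .
qed

end

theorem theorem3p7:
  fixes S1 B1 :: "'a set" and r1 :: "'a set \<Rightarrow> nat"
    and S2 B2 :: "'b set" and r2 :: "'b set \<Rightarrow> nat"
    and r :: "('a \<times> 'b) set \<Rightarrow> nat"
  assumes "matroid S1 r1" and "matroid S2 r2"
    and "matroid_basis S1 r1 B1" and "matroid_basis S2 r2 B2"
    and "matroid (S1 \<times> S2) r"
    and "\<And>e. e \<in> (S1 - B1) \<times> (S2 - B2) \<Longrightarrow> matroid_loop (S1 \<times> S2) r e"
    and "matroid_amalgam (S1 \<times> B2) (row_copies_rank S1 r1 B2)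
           (B1 \<times> S2) (column_copies_rank B1 S2 r2)
           ((S1 \<times> B2) \<union> (B1 \<times> S2)) r"
  shows "matroid_coupling S1 r1 S2 r2 r"
proof -
  interpret M1: matroid S1 r1 by fact
  interpret M2: matroid S2 r2 by fact
  interpret M: matroid "S1 \<times> S2" r by fact
  note B1 = M1.basis_subset[OF assms(3)] M1.rank_basis[OF assms(3)] M1.card_basis[OF assms(3)]
  note B2 = M2.basis_subset[OF assms(4)] M2.rank_basis[OF assms(4)] M2.card_basis[OF assms(4)]
  have fin: "finite B1" "finite B2"
    using B1(1) B2(1) M1.finite_ground M2.finite_ground by (auto intro: finite_subset)
  \<comment> \<open>The amalgam enters the proof only through its values on rectangles, recorded in
    \<open>row\<close> and \<open>col\<close>.\<close>
  have row: "r (X \<times> Y) = r1 X * card Y" if "X \<subseteq> S1" "Y \<subseteq> B2" for X Y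
  proof -
    have "X \<times> Y \<subseteq> S1 \<times> B2" using that by auto
    then have "r (X \<times> Y) = row_copies_rank S1 r1 B2 (X \<times> Y)"
      using assms(7) by (simp add: matroid_amalgam_def)
    then show ?thesis using M1.row_copies_rank_Times that fin by simp
  qed
  have col: "r (X \<times> Y) = card X * r2 Y" if "X \<subseteq> B1" "Y \<subseteq> S2" for X Y
  proof -
    have "X \<times> Y \<subseteq> B1 \<times> S2" using that by auto
    then have "r (X \<times> Y) = column_copies_rank B1 S2 r2 (X \<times> Y)"
      using assms(7) by (simp add: matroid_amalgam_def)
    then show ?thesis using M2.column_copies_rank_Times that fin by simp
  qed
  have loop: "r {e} = 0" if "e \<in> (S1 - B1) \<times> (S2 - B2)" for e
    using assms(6)[OF that] by (simp add: matroid_loop_def)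
  have "r (X \<times> S2) = r1 X * r2 S2" if X: "X \<subseteq> S1" for X
  proof -
    have "r (X \<times> S2) = r (X \<times> B2)"
    proof (rule M.rank_eq_if_spanned)
      fix e assume "e \<in> X \<times> S2 - X \<times> B2"
      then obtain x y where e: "e = (x, y)" "x \<in> X" "y \<in> S2 - B2" by auto
      show "\<exists>C\<subseteq>X \<times> B2. r (insert e C) \<le> r C"
      proof (cases "x \<in> B1")
        case True
        have "r (insert e ({x} \<times> B2)) \<le> r ({x} \<times> S2)"
          using e X B2(1) by (intro M.rank_mono) auto
        \<comment> \<open>As \<open>x\<close> lies in \<open>B1\<close>, \<open>col\<close> applies
          to both sides and gives \<open>r2 S2\<close> and \<open>r2 B2\<close>, which agree because
          \<open>B2\<close> is a basis.\<close>
        also have "\<dots> = r ({x} \<times> B2)"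
          using col[of "{x}"] True B2 by simp
        finally show ?thesis using e(2) by (intro exI[of _ "{x} \<times> B2"]) auto
      next
        case False
        \<comment> \<open>A loop is spanned by the empty set.\<close>
        then show ?thesis using loop[of e] e X by (intro exI[of _ "{}"]) auto
      qed
    qed (use X B2(1) in auto)
    \<comment> \<open>The factor \<open>card B2\<close> from \<open>row\<close> is
      \<open>r2 S2\<close>.\<close>
    then show ?thesis using row[of X B2] X B2(3) by simp
  qed
  moreover have "r (S1 \<times> Y) = r1 S1 * r2 Y" if Y: "Y \<subseteq> S2" for Y
  proof -
    have "r (S1 \<times> Y) = r (B1 \<times> Y)"
    proof (rule M.rank_eq_if_spanned)
      fix e assume "e \<in> S1 \<times> Y - B1 \<times> Y"
      then obtain x y where e: "e = (x, y)" "x \<in> S1 - B1" "y \<in> Y" by auto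
      show "\<exists>C\<subseteq>B1 \<times> Y. r (insert e C) \<le> r C"
      proof (cases "y \<in> B2")
        case True
        have "r (insert e (B1 \<times> {y})) \<le> r (S1 \<times> {y})"
          using e Y B1(1) by (intro M.rank_mono) auto
        \<comment> \<open>Here \<open>y\<close> lies in \<open>B2\<close>, so \<open>row\<close>
          evaluates both sides inside the copy of the first matroid at \<open>y\<close>, where
          \<open>B1\<close> has full rank.\<close>
        also have "\<dots> = r (B1 \<times> {y})"
          using row[of _ "{y}"] True B1 by simp
        finally show ?thesis using e(3) by (intro exI[of _ "B1 \<times> {y}"]) auto
      next
        case False
        then show ?thesis using loop[of e] e Y by (intro exI[of _ "{}"]) auto
      qed
    qed (use Y B1(1) in auto)
    then show ?thesis using col[of B1 Y] Y B1(3) by simp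
  qed
  ultimately show ?thesis
    using assms(5) by (simp add: matroid_coupling_def)
qed

end
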